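(* For all integers $n,k,i,j\ge 0$ let $\overline{C}_2(n;k;i,j)$ denote the number of jagged overpartitions of $n$ (as defined in the context) with exactly $k$ non-overlined parts, exactly $i$ parts of color $a$ and exactly $j$ parts of color $b$, satisfying the additional condition that the final $\ell$ parts are overlined, where $\ell$ is the number of parts of color $b$ or $u$. Then $$\sum_{n,k,i,j \geq 0} \overline{C}_2(n;k;i,j) a^ib^jq^n = (-q;q)_{\infty}(-aq;q)_{\infty}(-bq^2;q^2)_{\infty}.$$
   Context: Notation: $(x;q)_n=\prod_{m=0}^{n-1}(1-xq^m)$ for $n\in\mathbb{N}\cup\{\infty\}$. A jagged overpartition of $n$ is a finite sequence $(\lambda_1,\dots,\lambda_s)$ of non-negative integers with sum $n$, where each part carries one of three colors $a$, $b$, $u$, the final occurrence of a positive part may be overlined (zero parts are never overlined), the last part satisfies $\lambda_s\notin\{0_a,0_b,\overline{1}_a,\overline{1}_b\}$, and for each $i$ the difference $\lambda_i-\lambda_{i+1}$ is at least the entry of the following matrix in the row given by the type of $\lambda_i$ and the column given by the type of $\lambda_{i+1}$ (types: $\overline{a},\overline{b},\overline{u}$ for overlined parts of colors $a,b,u$; $a,b,u$ for non-overlined ones), columns in the order $\overline{a},\overline{b},\overline{u},a,b,u$: row $\overline{a}$: $2,0,2,2,0,2$; row $\overline{b}$: $2,2,3,2,2,3$; row $\overline{u}$: $1,0,1,1,0,1$; row $a$: $1,-1,1,1,-1,1$; row $b$: $1,1,2,1,1,2$; row $u$: $0,-1,0,0,-1,0$. Non-overlined parts include parts equal to $0$. 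*)

theory Defs
  imports "HOL-Analysis.Analysis"
begin

definition qpoch_inf :: "complex \<Rightarrow> complex \<Rightarrow> complex" where
  "qpoch_inf x q = (\<Prod>m. 1 - x * q ^ m)"

datatype color = A | B | U

datatype part = Part (size_of: nat) (color_of: color) (overlined: bool)

text \<open>Column order: overlined \<open>A\<close>, \<open>B\<close>, \<open>U\<close>, then non-overlined \<open>A\<close>, \<open>B\<close>, \<open>U\<close>.\<close>

fun gap_row :: "bool \<Rightarrow> color \<Rightarrow> int list" where
  "gap_row True A  = [2,  0, 2, 2,  0, 2]"
| "gap_row True B  = [2,  2, 3, 2,  2, 3]"
| "gap_row True U  = [1,  0, 1, 1,  0, 1]"
| "gap_row False A = [1, -1, 1, 1, -1, 1]"
| "gap_row False B = [1,  1, 2, 1,  1, 2]"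
| "gap_row False U = [0, -1, 0, 0, -1, 0]"

fun gap_column :: "bool \<Rightarrow> color \<Rightarrow> nat" where
  "gap_column True A  = 0"
| "gap_column True B  = 1"
| "gap_column True U  = 2"
| "gap_column False A = 3"
| "gap_column False B = 4"
| "gap_column False U = 5"

definition gap :: "part \<Rightarrow> part \<Rightarrow> int" where
  "gap p p' = gap_row (overlined p) (color_of p) ! gap_column (overlined p') (color_of p')"

text \<open>
  Sequences are lists, the first part being the head; the empty list is allowed, and it is
  the only jagged overpartition of 0 counted below. The first condition says that an overlined part
  is positive and is the final occurrence of its size in its color: equal sizes in
  different colors are different parts (the zero entries in the first row of the matrix allow an
  overlined \<open>v\<^sub>a\<close> to be followed by \<open>v\<^sub>b\<close>).
\<close>

definition jagged_overpartition :: "nat \<Rightarrow> part list \<Rightarrow> bool" where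
  "jagged_overpartition n ps \<longleftrightarrow>
     sum_list (map size_of ps) = n \<and>
     (\<forall>s < length ps. overlined (ps ! s) \<longrightarrow>
        size_of (ps ! s) > 0 \<and>
        (\<forall>t < length ps. s < t \<longrightarrow>
           (size_of (ps ! t), color_of (ps ! t)) \<noteq> (size_of (ps ! s), color_of (ps ! s)))) \<and>
     (ps \<noteq> [] \<longrightarrow> last ps \<notin> {Part 0 A False, Part 0 B False, Part 1 A True, Part 1 B True}) \<and>
     (\<forall>s. Suc s < length ps \<longrightarrow>
        int (size_of (ps ! s)) - int (size_of (ps ! Suc s)) \<ge> gap (ps ! s) (ps ! Suc s))"

definition final_parts_overlined :: "part list \<Rightarrow> bool" where
  "final_parts_overlined ps \<longleftrightarrow>
     (let l = length (filter (\<lambda>p. color_of p \<in> {B, U}) ps)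
      in \<forall>p \<in> set (drop (length ps - l) ps). overlined p)"

definition C2_set :: "nat \<Rightarrow> nat \<Rightarrow> nat \<Rightarrow> nat \<Rightarrow> part list set" where
  "C2_set n k i j =
     {ps. jagged_overpartition n ps \<and> final_parts_overlined ps \<and>
          length (filter (\<lambda>p. \<not> overlined p) ps) = k \<and>
          length (filter (\<lambda>p. color_of p = A) ps) = i \<and>
          length (filter (\<lambda>p. color_of p = B) ps) = j}"

definition C2 :: "nat \<Rightarrow> nat \<Rightarrow> nat \<Rightarrow> nat \<Rightarrow> nat" where
  "C2 n k i j = card (C2_set n k i j)"

text \<open>
  Zero parts do not count towards \<open>n\<close>, so the cardinality is that of a finite set only because
  the conditions force all parts to be positive.
\<close>

lemma C2_set_positive:
  assumes "ps \<in> C2_set n k i j" and "p \<in> set ps"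
  shows "size_of p > 0"
proof -
  define bad where "bad p \<longleftrightarrow> size_of p = 0 \<or> (size_of p = 1 \<and> color_of p = B)" for p
  have J: "jagged_overpartition n ps" and F: "final_parts_overlined ps"
    using assms(1) by (auto simp: C2_set_def)
  have step: "bad (ps ! Suc s)" if "Suc s < length ps" "bad (ps ! s)" for s
  proof -
    have "int (size_of (ps ! s)) - int (size_of (ps ! Suc s)) \<ge> gap (ps ! s) (ps ! Suc s)"
      using J that(1) by (auto simp: jagged_overpartition_def)
    moreover have "overlined (ps ! s) \<Longrightarrow> size_of (ps ! s) > 0"
      using J that(1) by (auto simp: jagged_overpartition_def)
    moreover have "overlined (ps ! Suc s) \<Longrightarrow> size_of (ps ! Suc s) > 0"
      using J that(1) by (auto simp: jagged_overpartition_def)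
    ultimately show ?thesis
      using that(2) unfolding bad_def gap_def
      by (cases "ps ! s"; cases "ps ! Suc s"; cases "color_of (ps ! s)";
          cases "color_of (ps ! Suc s)"; cases "overlined (ps ! s)";
          cases "overlined (ps ! Suc s)"; force)
  qed
  have "ps \<noteq> []" using assms(2) by auto
  have last: "\<not> bad (last ps)"
  proof
    assume bad: "bad (last ps)"
    have L: "last ps \<notin> {Part 0 A False, Part 0 B False, Part 1 A True, Part 1 B True}"
      and O: "overlined (last ps) \<Longrightarrow> size_of (last ps) > 0"
      using J \<open>ps \<noteq> []\<close> by (auto simp: jagged_overpartition_def last_conv_nth)
    define l where "l = length (filter (\<lambda>p. color_of p \<in> {B, U}) ps)"
    have "overlined (last ps)" if "color_of (last ps) \<in> {B, U}"
    proof -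
      have "filter (\<lambda>p. color_of p \<in> {B, U}) ps \<noteq> []"
        using that \<open>ps \<noteq> []\<close> last_in_set[OF \<open>ps \<noteq> []\<close>] by (auto simp: filter_empty_conv)
      then have "0 < l" unfolding l_def by (simp only: length_greater_0_conv not_False_eq_True)
      with \<open>ps \<noteq> []\<close> have "length ps - l < length ps"
        by (metis diff_less length_greater_0_conv)
      then have "drop (length ps - l) ps \<noteq> []" by simp
      then have "last ps \<in> set (drop (length ps - l) ps)"
        by (metis last_drop last_in_set drop_eq_Nil not_le)
      then show ?thesis
        using F by (auto simp: final_parts_overlined_def l_def Let_def)
    qed
    then show False
      using bad L O unfolding bad_def
      by (cases "last ps"; cases "color_of (last ps)"; cases "overlined (last ps)"; auto)
  qed
  have "\<not> bad (ps ! s)" if "s < length ps" for s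
  proof
    assume b: "bad (ps ! s)"
    have "bad (ps ! (s + d))" if "s + d < length ps" for d
      using that by (induction d) (use b step in auto)
    from this[of "length ps - 1 - s"] last \<open>ps \<noteq> []\<close> \<open>s < length ps\<close> show False
      by (simp add: last_conv_nth)
  qed
  then show ?thesis
    using assms(2) unfolding bad_def by (metis in_set_conv_nth gr0I)
qed

lemma finite_C2_set: "finite (C2_set n k i j)"
proof -
  define S where "S = (\<lambda>(v, c, o'). Part v c o') ` ({..n} \<times> {A, B, U} \<times> {True, False})"
  have "finite S" unfolding S_def by simp
  have "C2_set n k i j \<subseteq> {ps. set ps \<subseteq> S \<and> length ps \<le> n}"
  proof safe
    fix ps assume ps: "ps \<in> C2_set n k i j"
    then have sum: "sum_list (map size_of ps) = n"
      by (auto simp: C2_set_def jagged_overpartition_def)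
    have "sum_list (map (\<lambda>_. 1) ps) \<le> sum_list (map size_of ps)"
      using C2_set_positive[OF ps] by (intro sum_list_mono) (auto simp: Suc_le_eq)
    then show "length ps \<le> n" by (simp add: sum sum_list_triv)
    fix p assume "p \<in> set ps"
    then have "size_of p \<le> n"
      using member_le_sum_list[of "size_of p" "map size_of ps"] sum by auto
    then show "p \<in> S"
      unfolding S_def by (cases p; cases "color_of p"; cases "overlined p"; force)
  qed
  then show ?thesis
    using finite_lists_length_le[OF \<open>finite S\<close>] finite_subset by blast
qed

end

theory Submission
  imports Defs
begin

text \<open>
  Lowering the size of every part of color \<open>B\<close> by one turns the gap matrix into a 0/1 matrix plus
  one for each overlined part on the left. Hence this adjusted size never increases along a jagged
  overpartition and drops after an overlined part, so positivity of the parts and the final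
  occurrence condition come for free. Read from its last part, a jagged overpartition is a color
  word with overlines and arbitrary non-negative excesses over the minimal gaps. Removing the last
  part gives a recurrence, whose solution for \<open>i\<close>, \<open>j\<close>, \<open>r\<close> parts of color \<open>A\<close>, \<open>B\<close>, \<open>U\<close> is
  \[ \frac{q^{i(i+1)/2}}{(q;q)_i} \cdot \frac{q^{j(j+1)}}{(q^2;q^2)_j} \cdot (-q;q)_{i+j}
     \cdot \frac{q^{r(r+1)/2 + (i+j)r}}{(q;q)_r}. \]
  Euler's identity sums this over \<open>r\<close>, \<open>j\<close> and \<open>i\<close>. Summability is obtained first for non-negative
  \<open>a\<close>, \<open>b\<close>, \<open>q\<close>, where it follows from the evaluation itself, and then by comparison of norms.
\<close>

section \<open>Summation over the fibres of a map\<close>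

text \<open>Either alternative justifies regrouping a sum, so an evaluation below can serve twice:
  on non-negative terms, where it yields summability, and then on complex terms.\<close>

definition summable_or_nonneg :: "('a \<Rightarrow> complex) \<Rightarrow> 'a set \<Rightarrow> bool" where
  "summable_or_nonneg f D \<longleftrightarrow> f summable_on D \<or> (\<forall>x\<in>D. f x \<in> \<real>\<^sub>\<ge>\<^sub>0)"

lemma summable_or_nonneg_subset:
  "summable_or_nonneg f D \<Longrightarrow> E \<subseteq> D \<Longrightarrow> summable_or_nonneg f E"
  unfolding summable_or_nonneg_def using summable_on_subset_banach by blast

text \<open>Tonelli: the terms equal their real parts, and a non-negative real family is summable
  once its iterated sums are.\<close>

lemma has_sum_SigmaI_nonneg_complex:
  fixes f :: "'b \<times> 'c \<Rightarrow> complex"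
  assumes f: "\<And>x. x \<in> D \<Longrightarrow> ((\<lambda>y. f (x, y)) has_sum g x) (E x)"
    and g: "(g has_sum S) D"
    and nonneg: "\<And>z. z \<in> Sigma D E \<Longrightarrow> f z \<in> \<real>\<^sub>\<ge>\<^sub>0"
  shows "(f has_sum S) (Sigma D E)"
proof (rule has_sum_SigmaI[OF f g])
  have Re: "f z = of_real (Re (f z))" "Re (f z) \<ge> 0" if "z \<in> Sigma D E" for z
    using nonneg[OF that] by (auto simp: complex_nonneg_Reals_iff complex_eq_iff)
  have "(\<lambda>z. Re (f z)) summable_on Sigma D E"
  proof (rule summable_on_SigmaI)
    show "((\<lambda>y. Re (f (x, y))) has_sum Re (g x)) (E x)" if "x \<in> D" for x
      using has_sum_Re[OF f[OF that]] by simp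
    show "(\<lambda>x. Re (g x)) summable_on D"
      using has_sum_Re[OF g] by (auto simp: summable_on_def)
    show "0 \<le> Re (f (x, y))" if "x \<in> D" "y \<in> E x" for x y
      using Re(2)[of "(x, y)"] that by auto
  qed
  then have "(\<lambda>z. of_real (Re (f z)) :: complex) summable_on Sigma D E"
    by (rule summable_on_of_real)
  then show "f summable_on Sigma D E"
    using Re(1) summable_on_cong[of "Sigma D E" f "\<lambda>z. of_real (Re (f z))"] by simp
qed

text \<open>The graph map from \<open>x\<close> to \<open>(g x, x)\<close> identifies
  \<open>X\<close> with the disjoint union of the fibres of \<open>g\<close>.\<close>

lemma has_sum_fibres:
  fixes f :: "'b \<Rightarrow> complex"
  assumes f: "\<And>y. y \<in> Y \<Longrightarrow> (f has_sum S y) {x \<in> X. g x = y}"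
    and S: "(S has_sum s) Y"
    and g: "g ` X \<subseteq> Y"
    and X: "summable_or_nonneg f X"
  shows "(f has_sum s) X"
proof -
  let ?G = "Sigma Y (\<lambda>y. {x \<in> X. g x = y})"
  have bij: "bij_betw (\<lambda>x. (g x, x)) X ?G"
    by (rule bij_betwI[of _ _ _ snd]) (use g in auto)
  have "((\<lambda>z. f (snd z)) has_sum s) ?G"
    using X unfolding summable_or_nonneg_def
  proof
    assume "f summable_on X"
    then have "(\<lambda>z. f (snd z)) summable_on ?G"
      using summable_on_reindex_bij_betw[OF bij, of "\<lambda>z. f (snd z)"] by simp
    then show ?thesis
      by (intro has_sum_SigmaI[OF _ S]) (use f in auto)
  next
    assume "\<forall>x\<in>X. f x \<in> \<real>\<^sub>\<ge>\<^sub>0"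
    then show ?thesis
      by (intro has_sum_SigmaI_nonneg_complex[OF _ S]) (use f in auto)
  qed
  then show ?thesis
    using has_sum_reindex_bij_betw[OF bij, of "\<lambda>z. f (snd z)"] by simp
qed

lemma has_sum_fibresD:
  fixes f :: "'b \<Rightarrow> complex"
  assumes "(f has_sum s) X"
    and f: "\<And>y. y \<in> Y \<Longrightarrow> (f has_sum S y) {x \<in> X. g x = y}"
    and g: "g ` X \<subseteq> Y"
  shows "(S has_sum s) Y"
proof -
  let ?G = "Sigma Y (\<lambda>y. {x \<in> X. g x = y})"
  have bij: "bij_betw (\<lambda>x. (g x, x)) X ?G"
    by (rule bij_betwI[of _ _ _ snd]) (use g in auto)
  have "((\<lambda>z. f (snd z)) has_sum s) ?G"
    using assms(1) has_sum_reindex_bij_betw[OF bij, of "\<lambda>z. f (snd z)"] by simp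
  then show ?thesis
    by (rule has_sum_SigmaD) (use f in auto)
qed

lemma has_sum_geometric_atLeast:
  fixes x :: complex
  assumes "norm x < 1"
  shows "((\<lambda>k. x ^ k) has_sum (x ^ M / (1 - x))) {M..}"
proof -
  have "((\<lambda>k. x ^ k) has_sum (1 / (1 - x))) UNIV"
    by (rule norm_summable_imp_has_sum)
       (use assms geometric_sums[OF assms] in \<open>auto simp: norm_power summable_geometric\<close>)
  then have "((\<lambda>k. x ^ M * x ^ k) has_sum (x ^ M * (1 / (1 - x)))) UNIV"
    by (rule has_sum_cmult_right)
  moreover have "bij_betw (\<lambda>k. M + k) UNIV {M..}"
    by (rule bij_betwI[of _ _ _ "\<lambda>k. k - M"]) auto
  ultimately show ?thesis
    using has_sum_reindex_bij_betw[of "\<lambda>k. M + k" UNIV "{M..}" "\<lambda>k. x ^ k"]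
    by (simp add: power_add)
qed

section \<open>Euler's identity\<close>

definition qpoch :: "complex \<Rightarrow> complex \<Rightarrow> nat \<Rightarrow> complex" where
  "qpoch x q n = (\<Prod>k<n. 1 - x * q ^ k)"

text \<open>This is x^r q^(r(r-1)/2) / (q;q)_r, as a product that shows the ratio of consecutive
  terms.\<close>

definition euler_term :: "complex \<Rightarrow> complex \<Rightarrow> nat \<Rightarrow> complex" where
  "euler_term x q r = (\<Prod>k<r. x * q ^ k / (1 - q ^ Suc k))"

lemma one_minus_power_nonzero:
  fixes q :: complex
  assumes "norm q < 1" and "k > 0"
  shows "1 - q ^ k \<noteq> 0"
proof
  assume "1 - q ^ k = 0"
  then have "norm (q ^ k) = 1" by (metis eq_iff_diff_eq_0 norm_one)
  moreover have "norm (q ^ k) < 1"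
    using assms by (simp add: norm_power power_less_one_iff)
  ultimately show False by simp
qed

lemma one_plus_power_nonzero:
  fixes q :: complex
  assumes "norm q < 1" and "k > 0"
  shows "1 + q ^ k \<noteq> 0"
proof
  assume "1 + q ^ k = 0"
  then have "q ^ k = - 1" by (simp add: add_eq_0_iff)
  then have "norm (q ^ k) = 1" by simp
  moreover have "norm (q ^ k) < 1"
    using assms by (simp add: norm_power power_less_one_iff)
  ultimately show False by simp
qed

lemma qpoch_tendsto:
  assumes "norm q < 1"
  shows "qpoch x q \<longlonglongrightarrow> qpoch_inf x q"
proof -
  have "summable (\<lambda>k. norm x * norm q ^ k)"
    using assms by (intro summable_mult summable_geometric) auto
  then have "convergent_prod (\<lambda>k. 1 - x * q ^ k)"
    by (intro abs_convergent_prod_imp_convergent_prod summable_imp_abs_convergent_prod)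
       (simp add: norm_mult norm_power)
  then show ?thesis
    using convergent_prod_LIMSEQ unfolding qpoch_def qpoch_inf_def
    by (subst LIMSEQ_lessThan_iff_atMost) blast
qed

text \<open>Lets the factor (-q;q)_(i+j) complete the infinite product that the sum over the parts
  of color \<open>U\<close> leaves.\<close>

lemma qpoch_inf_split:
  assumes "norm q < 1"
  shows "qpoch x q n * qpoch_inf (x * q ^ n) q = qpoch_inf x q"
proof -
  have "qpoch x q (k + n) = qpoch x q n * qpoch (x * q ^ n) q k" for k
    by (induction k) (simp_all add: qpoch_def power_add mult_ac)
  then have "(\<lambda>k. qpoch x q n * qpoch (x * q ^ n) q k) \<longlonglongrightarrow> qpoch_inf x q"
    using LIMSEQ_ignore_initial_segment[OF qpoch_tendsto[OF assms], of x n] by simp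
  moreover have "(\<lambda>k. qpoch x q n * qpoch (x * q ^ n) q k)
                   \<longlonglongrightarrow> qpoch x q n * qpoch_inf (x * q ^ n) q"
    by (intro tendsto_mult tendsto_const qpoch_tendsto assms)
  ultimately show ?thesis
    using LIMSEQ_unique by blast
qed

lemma euler_term_0 [simp]: "euler_term x q 0 = 1"
  by (simp add: euler_term_def)

lemma euler_term_Suc: "euler_term x q (Suc r) = euler_term x q r * (x * q ^ r / (1 - q ^ Suc r))"
  by (simp add: euler_term_def)

lemma euler_term_eq: "euler_term x q r = euler_term 1 q r * x ^ r"
  by (induction r) (simp_all add: euler_term_Suc)

lemma summable_norm_euler_term:
  assumes q: "norm q < 1"
  shows "summable (\<lambda>r. norm (euler_term x q r))"
proof -
  have "(\<lambda>r. q ^ r) \<longlonglongrightarrow> 0"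
    using q by (rule LIMSEQ_power_zero)
  then have "(\<lambda>r. norm (x * q ^ r / (1 - q ^ Suc r))) \<longlonglongrightarrow> norm (x * 0 / (1 - 0))"
    by (intro tendsto_norm tendsto_divide tendsto_mult tendsto_diff tendsto_const LIMSEQ_Suc[of "\<lambda>r. q ^ r"]) auto
  then have "\<forall>\<^sub>F r in sequentially. norm (x * q ^ r / (1 - q ^ Suc r)) < 1 / 2"
    by (rule order_tendstoD) simp
  then obtain N where N: "\<And>r. r \<ge> N \<Longrightarrow> norm (x * q ^ r / (1 - q ^ Suc r)) < 1 / 2"
    by (auto simp: eventually_at_top_linorder)
  show ?thesis
  proof (rule summable_ratio_test[of "1/2" N])
    fix r assume "r \<ge> N"
    then have "norm (euler_term x q r) * norm (x * q ^ r / (1 - q ^ Suc r))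
                 \<le> norm (euler_term x q r) * (1 / 2)"
      by (intro mult_left_mono less_imp_le[OF N]) auto
    then show "norm (norm (euler_term x q (Suc r))) \<le> 1 / 2 * norm (norm (euler_term x q r))"
      unfolding euler_term_Suc norm_mult[of "euler_term x q r"] by simp
  qed simp
qed

text \<open>
  The series $F(x)$ satisfies $F(x) = (1+x) F(xq)$, which iterates to
  $F(x) = F(xq^n) \prod_{k<n} (1+xq^k)$; now let $n \to \infty$.
\<close>

lemma euler_identity:
  assumes q: "norm q < 1"
  shows "(euler_term x q has_sum qpoch_inf (- x) q) UNIV"
proof -
  define F where "F x = (\<Sum>r. euler_term x q r)" for x
  have sums: "euler_term x q sums F x" for x
    unfolding F_def by (rule summable_sums[OF summable_norm_cancel[OF summable_norm_euler_term[OF q]]])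
  have F0: "F 0 = 1"
  proof -
    have "euler_term 0 q = (\<lambda>r. if r = 0 then 1 else 0)"
    proof
      show "euler_term 0 q r = (if r = 0 then 1 else 0)" for r
        by (cases r) (simp_all add: euler_term_Suc)
    qed
    then have "euler_term 0 q sums 1"
      using sums_single[of 0 "\<lambda>_. 1 :: complex"] by simp
    then show ?thesis using sums[of 0] sums_unique2 by blast
  qed
  have step: "F x = (1 + x) * F (x * q)" for x
  proof -
    \<comment> \<open>Passing from x to x q multiplies the term of index r+1 by q^(r+1), so the
      difference carries 1 - q^(r+1), which cancels the last denominator.\<close>
    have eq: "euler_term x q (Suc r) - euler_term (x * q) q (Suc r) = x * euler_term (x * q) q r" for r
    proof -
      have "euler_term x q (Suc r) - euler_term (x * q) q (Suc r)
              = euler_term 1 q (Suc r) * x ^ Suc r * (1 - q ^ Suc r)"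
        unfolding euler_term_eq[of x] euler_term_eq[of "x * q"]
          by (simp add: power_mult_distrib algebra_simps)
      also have "\<dots> = euler_term 1 q r * q ^ r * x ^ Suc r"
        using one_minus_power_nonzero[OF q, of "Suc r"] by (simp add: euler_term_Suc del: power_Suc)
      also have "\<dots> = x * euler_term (x * q) q r"
        unfolding euler_term_eq[of "x * q"] by (simp add: power_mult_distrib)
      finally show ?thesis .
    qed
    have "(\<lambda>r. euler_term x q r - euler_term (x * q) q r) sums (F x - F (x * q))"
      by (intro sums_diff sums)
    \<comment> \<open>Both terms of index 0 are 1, so the series of differences may start at index
      1.\<close>
    then have "(\<lambda>r. euler_term x q (Suc r) - euler_term (x * q) q (Suc r)) sums (F x - F (x * q))"
      by (subst sums_Suc_iff) simp
    then have "(\<lambda>r. x * euler_term (x * q) q r) sums (F x - F (x * q))"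
      by (simp only: eq)
    moreover have "(\<lambda>r. x * euler_term (x * q) q r) sums (x * F (x * q))"
      by (intro sums_mult sums)
    ultimately have "F x - F (x * q) = x * F (x * q)"
      by (rule sums_unique2)
    then show ?thesis by (simp add: algebra_simps)
  qed
  have iter: "F x = qpoch (- x) q n * F (x * q ^ n)" for n
  proof (induction n)
    case (Suc n)
    then show ?case
      using step[of "x * q ^ n"] by (simp add: qpoch_def mult_ac)
  qed (simp add: qpoch_def)
  \<comment> \<open>A power series that converges everywhere is continuous, which sends F(x q^n) to
    F(0) = 1.\<close>
  have "isCont F 0"
  proof -
    have eq: "euler_term y q = (\<lambda>r. euler_term 1 q r * y ^ r)" for y
      using euler_term_eq by blast
    have "summable (\<lambda>r. euler_term 1 q r * y ^ r)" for y
      using sums_summable[OF sums[of y]] by (simp only: eq[of y])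
    then have "isCont (\<lambda>y. \<Sum>r. euler_term 1 q r * y ^ r) 0"
      by (rule isCont_powser_converges_everywhere)
    moreover have "(\<lambda>y. \<Sum>r. euler_term 1 q r * y ^ r) = F"
      by (rule ext) (simp only: F_def eq[symmetric])
    ultimately show ?thesis by simp
  qed
  moreover have "(\<lambda>n. x * q ^ n) \<longlonglongrightarrow> 0"
    using tendsto_mult[OF tendsto_const LIMSEQ_power_zero[OF q], of x] by simp
  ultimately have "(\<lambda>n. F (x * q ^ n)) \<longlonglongrightarrow> 1"
    using isCont_tendsto_compose[of 0 F] F0 by fastforce
  then have "(\<lambda>n. qpoch (- x) q n * F (x * q ^ n)) \<longlonglongrightarrow> qpoch_inf (- x) q * 1"
    by (intro tendsto_mult qpoch_tendsto q)
  then have "F x = qpoch_inf (- x) q"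
    using iter by (simp add: LIMSEQ_const_iff)
  then show ?thesis
    using norm_summable_imp_has_sum[OF summable_norm_euler_term[OF q] sums[of x]] by simp
qed

section \<open>Jagged overpartitions in terms of keys\<close>

definition jag :: "color \<Rightarrow> nat" where
  "jag c = of_bool (c = B)"

text \<open>
  In terms of the size lowered by one for the parts of color \<open>B\<close>, all entries of the gap
  matrix become non-negative.
\<close>

definition key :: "part \<Rightarrow> int" where
  "key p = int (size_of p) - int (jag (color_of p))"

definition key_gap :: "color \<Rightarrow> color \<Rightarrow> nat" where
  "key_gap c c' = (if c = U \<or> c = A \<and> c' = B \<or> c = B \<and> c' = A then 0 else 1)"

lemma jag_simps [simp]: "jag A = 0" "jag B = 1" "jag U = 0"
  by (simp_all add: jag_def)

lemma key_gap_simps [simp]: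
  "key_gap A A = 1" "key_gap A B = 0" "key_gap A U = 1"
  "key_gap B A = 0" "key_gap B B = 1" "key_gap B U = 1"
  "key_gap U c = 0"
  by (simp_all add: key_gap_def)

text \<open>A finite check: each overlined row exceeds its plain row by one, the last three columns
  repeat the first three, and the shift by \<open>jag\<close> absorbs the remaining differences from
  \<open>key_gap\<close>.\<close>

lemma gap_le_iff:
  "gap p p' \<le> int (size_of p) - int (size_of p')
     \<longleftrightarrow> key p' + int (key_gap (color_of p) (color_of p')) + of_bool (overlined p) \<le> key p"
  by (cases "color_of p"; cases "color_of p'"; cases "overlined p"; cases "overlined p'")
     (auto simp: gap_def key_def)

definition color_count :: "color \<Rightarrow> part list \<Rightarrow> nat" where
  "color_count c ps = length (filter (\<lambda>p. color_of p = c) ps)"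

lemma color_count_simps [simp]:
  "color_count c [] = 0"
  "color_count c (p # ps) = of_bool (color_of p = c) + color_count c ps"
  by (simp_all add: color_count_def)

lemma color_count_rev [simp]: "color_count c (rev ps) = color_count c ps"
  by (simp add: color_count_def rev_filter[symmetric])

lemma length_eq_color_count: "length ps = color_count A ps + color_count B ps + color_count U ps"
proof (induction ps)
  case (Cons p ps)
  then show ?case by (cases "color_of p") auto
qed simp

text \<open>
  Lists are read here from the last part on. The parameter \<open>I\<close> is the number of leading parts,
  in the original order, that need not be overlined, and \<open>m\<close>, \<open>c\<close> are the key and the color
  of a virtual part that precedes the list.
\<close>

fun admissible :: "nat \<Rightarrow> nat \<Rightarrow> color \<Rightarrow> part list \<Rightarrow> bool" where
  "admissible I m c [] \<longleftrightarrow> True"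
| "admissible I m c (p # ps) \<longleftrightarrow>
     m + key_gap (color_of p) c + of_bool (overlined p) + jag (color_of p) \<le> size_of p \<and>
     (I \<le> length ps \<longrightarrow> overlined p) \<and>
     admissible I (size_of p - jag (color_of p)) (color_of p) ps"

text \<open>\<open>length ps\<close> counts the parts before \<open>p\<close> in the original order,
  so the overline clause spares exactly the first \<open>I\<close> parts. The truncated subtraction
  of \<open>jag\<close> is exact, since the bound on \<open>p\<close> already gives
  \<open>jag (color_of p) \<le> size_of p\<close>.\<close>

lemma admissible_iff:
  "admissible I m c ps \<longleftrightarrow>
     (ps \<noteq> [] \<longrightarrow> m + key_gap (color_of (hd ps)) c + of_bool (overlined (hd ps))
                    + jag (color_of (hd ps)) \<le> size_of (hd ps)) \<and>
     successively (\<lambda>p' p. gap p p' \<le> int (size_of p) - int (size_of p')) ps \<and>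
     (\<forall>p\<in>set (take (length ps - I) ps). overlined p)"
proof (induction ps arbitrary: m c)
  case (Cons p ps)
  have "(\<forall>p\<in>set (take (length (p # ps) - I) (p # ps)). overlined p) \<longleftrightarrow>
          (I \<le> length ps \<longrightarrow> overlined p) \<and> (\<forall>p\<in>set (take (length ps - I) ps). overlined p)"
    by (cases "I \<le> length ps") (auto simp: Suc_diff_le)
  moreover have "successively (\<lambda>p' p. gap p p' \<le> int (size_of p) - int (size_of p')) (p # ps) \<longleftrightarrow>
      (ps \<noteq> [] \<longrightarrow> gap (hd ps) p \<le> int (size_of (hd ps)) - int (size_of p)) \<and>
      successively (\<lambda>p' p. gap p p' \<le> int (size_of p) - int (size_of p')) ps"
    by (cases ps) auto
  moreover have "gap (hd ps) p \<le> int (size_of (hd ps)) - int (size_of p) \<longleftrightarrow>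
      size_of p - jag (color_of p) + key_gap (color_of (hd ps)) (color_of p)
        + of_bool (overlined (hd ps)) + jag (color_of (hd ps)) \<le> size_of (hd ps)"
    if "jag (color_of p) \<le> size_of p"
    unfolding gap_le_iff using that by (auto simp: key_def of_nat_diff)
  ultimately show ?case
    unfolding admissible.simps Cons.IH list.sel by auto
qed auto

text \<open>A virtual part of color \<open>A\<close> and key 0 after the last part encodes the
  exclusions: it forces size at least 1 for plain \<open>A\<close> or \<open>B\<close> and 2 for
  overlined \<open>A\<close> or \<open>B\<close>; for \<open>U\<close> it forces only positivity of
  an overlined part.\<close>

lemma last_jagged_iff:
  assumes "overlined p \<Longrightarrow> size_of p > 0" and "color_of p = B \<Longrightarrow> overlined p"
  shows "p \<notin> {Part 0 A False, Part 0 B False, Part 1 A True, Part 1 B True} \<longleftrightarrow>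
           key_gap (color_of p) A + of_bool (overlined p) + jag (color_of p) \<le> size_of p"
  using assms by (cases p; cases "color_of p"; cases "overlined p") auto

section \<open>Monotonicity of keys\<close>

context
  fixes ps :: "part list"
  assumes gaps: "\<And>s. Suc s < length ps \<Longrightarrow>
    gap (ps ! s) (ps ! Suc s) \<le> int (size_of (ps ! s)) - int (size_of (ps ! Suc s))"
begin

text \<open>By \<open>gap_le_iff\<close> no step to the next part raises the key. Of the chained
  drops only the one forced by an overline on \<open>ps ! s\<close> is kept; it excludes later equal
  parts.\<close>

lemma key_less:
  assumes "s < t" "t < length ps"
  shows "key (ps ! t) + of_bool (overlined (ps ! s)) \<le> key (ps ! s)"
proof -
  have "Suc s + d < length ps \<Longrightarrow>
          key (ps ! (Suc s + d)) + of_bool (overlined (ps ! s)) \<le> key (ps ! s)" for d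
  proof (induction d)
    case 0
    then show ?case using gaps[of s] unfolding gap_le_iff by simp
  next
    case (Suc d)
    then have "key (ps ! (Suc s + Suc d)) + of_bool (overlined (ps ! (Suc s + d))) \<le> key (ps ! (Suc s + d))"
      using gaps[of "Suc s + d"] unfolding gap_le_iff by simp
    moreover have "(0 :: int) \<le> of_bool (overlined (ps ! (Suc s + d)))" by simp
    ultimately show ?case using Suc by linarith
  qed
  from this[of "t - Suc s"] show ?thesis using assms by simp
qed

lemma last_key_le:
  assumes "p \<in> set ps"
  shows "key (last ps) \<le> key p"
proof -
  obtain s where s: "s < length ps" "p = ps ! s"
    using assms by (auto simp: in_set_conv_nth)
  have "ps \<noteq> []" using assms by auto
  then have last: "last ps = ps ! (length ps - 1)" by (simp add: last_conv_nth)
  show ?thesis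
  proof (cases "s = length ps - 1")
    case False
    with s have "s < length ps - 1" by simp
    then show ?thesis
      using key_less[of s "length ps - 1"] s last \<open>ps \<noteq> []\<close>
      by (cases "overlined (ps ! s)") auto
  qed (use s last in simp)
qed

end

text \<open>The parts of color \<open>B\<close> or \<open>U\<close> number
  \<open>length ps - i\<close>, so the final overline condition is that of \<open>admissible\<close>
  with \<open>I = i\<close>. Positivity and final occurrence, absent from \<open>admissible\<close>,
  are recovered from the keys.\<close>

lemma jagged_overpartition_iff:
  fixes ps :: "part list"
  assumes n: "n = sum_list (map size_of ps)"
    and i: "i = color_count A ps"
  shows "jagged_overpartition n ps \<and> final_parts_overlined ps \<longleftrightarrow> admissible i 0 A (rev ps)"
proof -
  define gaps where "gaps \<longleftrightarrow> (\<forall>s. Suc s < length ps \<longrightarrow>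
     int (size_of (ps ! s)) - int (size_of (ps ! Suc s)) \<ge> gap (ps ! s) (ps ! Suc s))"
  have gaps_iff: "successively (\<lambda>p' p. gap p p' \<le> int (size_of p) - int (size_of p')) (rev ps) \<longleftrightarrow> gaps"
    unfolding gaps_def successively_rev by (auto simp: successively_conv_nth)
  have "length (filter (\<lambda>p. color_of p \<in> {B, U}) xs) = color_count B xs + color_count U xs" for xs
    by (induction xs) (auto simp: color_count_def)
  then have l: "length ps - length (filter (\<lambda>p. color_of p \<in> {B, U}) ps) = i"
    unfolding i using length_eq_color_count[of ps] by simp
  have "i \<le> length ps"
    unfolding i using length_eq_color_count[of ps] by simp
  then have over_iff: "final_parts_overlined ps \<longleftrightarrow>
      (\<forall>p\<in>set (take (length (rev ps) - i) (rev ps)). overlined p)"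
    unfolding final_parts_overlined_def Let_def l by (auto simp: take_rev)
  have last_over: "overlined (last ps)"
    if "final_parts_overlined ps" "ps \<noteq> []" "color_of (last ps) \<noteq> A"
  proof -
    from that(2) obtain p qs where ps: "rev ps = p # qs"
      by (metis list.exhaust rev_is_Nil_conv)
    then have last: "last ps = p"
      by (metis last_rev list.sel(1) rev_rev_ident list.distinct(1))
    \<comment> \<open>The last part \<open>p\<close> is not of color \<open>A\<close>, so all
      \<open>i\<close> parts of that color lie in \<open>qs\<close> and \<open>p\<close> is in the
      stretch that must be overlined.\<close>
    have "i \<le> length qs"
      using ps that(3) unfolding i last color_count_rev[symmetric, of A ps]
      by (simp add: color_count_def)
    then show ?thesis
      using that(1) unfolding over_iff ps last by (simp add: Suc_diff_le)
  qed
  have final: "(ps \<noteq> [] \<longrightarrow> last ps \<notin> {Part 0 A False, Part 0 B False, Part 1 A True, Part 1 B True}) \<and>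
       (\<forall>p\<in>set ps. overlined p \<longrightarrow> size_of p > 0) \<longleftrightarrow>
     (ps \<noteq> [] \<longrightarrow> 0 + key_gap (color_of (hd (rev ps))) A + of_bool (overlined (hd (rev ps)))
                    + jag (color_of (hd (rev ps))) \<le> size_of (hd (rev ps)))"
    if g: "gaps" and f: "final_parts_overlined ps"
  proof (cases "ps = []")
    case False
    have *: "color_of (last ps) = B \<Longrightarrow> overlined (last ps)"
      using last_over[OF f False] by auto
    show ?thesis (is "?L \<longleftrightarrow> ?R")
    proof
      assume ?L
      then show ?R
        using last_jagged_iff[OF _ *] False by (simp add: hd_rev)
    next
      assume ?R
      then have R: "key_gap (color_of (last ps)) A + of_bool (overlined (last ps))
                    + jag (color_of (last ps)) \<le> size_of (last ps)"
        using False by (simp add: hd_rev)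
      \<comment> \<open>For \<open>A\<close> the gap 1 to the virtual part gives this; for
        \<open>B\<close> and \<open>U\<close> that gap is 0 and the forced overline supplies the
        unit.\<close>
      have key: "key (last ps) \<ge> 1"
      proof (cases "color_of (last ps)")
        case A then show ?thesis using R by (simp add: key_def)
      next
        case B then show ?thesis using R * by (simp add: key_def)
      next
        case U then show ?thesis using R last_over[OF f False] by (simp add: key_def)
      qed
      have pos: "size_of p > 0" if "p \<in> set ps" for p
      proof -
        have "key (last ps) \<le> key p"
          using g that unfolding gaps_def by (intro last_key_le) auto
        then show ?thesis using key by (simp add: key_def)
      qed
      moreover have "last ps \<notin> {Part 0 A False, Part 0 B False, Part 1 A True, Part 1 B True}"
        using last_jagged_iff[OF _ *] R pos False by simp
      ultimately show ?L by blast
    qed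
  qed simp
  \<comment> \<open>Equal size and color would mean equal keys, against the drop after an overlined
    part.\<close>
  have occ: "(size_of (ps ! t), color_of (ps ! t)) \<noteq> (size_of (ps ! s), color_of (ps ! s))"
    if g: "gaps" and "s < t" "t < length ps" "overlined (ps ! s)" for s t
  proof -
    have "key (ps ! t) + of_bool (overlined (ps ! s)) \<le> key (ps ! s)"
      using g that unfolding gaps_def by (intro key_less) auto
    then show ?thesis using that(4) by (auto simp: key_def)
  qed
  have "jagged_overpartition n ps \<longleftrightarrow>
      (\<forall>p\<in>set ps. overlined p \<longrightarrow> size_of p > 0) \<and>
      (\<forall>s t. s < t \<and> t < length ps \<and> overlined (ps ! s) \<longrightarrow>
           (size_of (ps ! t), color_of (ps ! t)) \<noteq> (size_of (ps ! s), color_of (ps ! s))) \<and>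
      (ps \<noteq> [] \<longrightarrow> last ps \<notin> {Part 0 A False, Part 0 B False, Part 1 A True, Part 1 B True}) \<and> gaps"
    unfolding jagged_overpartition_def gaps_def all_set_conv_all_nth n
    by (auto dest: order.strict_trans)
  then show ?thesis
    unfolding admissible_iff gaps_iff over_iff[symmetric]
    using final occ by auto
qed

section \<open>The generating function for fixed color counts\<close>

definition weight :: "complex \<Rightarrow> part list \<Rightarrow> complex" where
  "weight q ps = q ^ sum_list (map size_of ps)"

lemma weight_simps [simp]: "weight q [] = 1" "weight q (p # ps) = q ^ size_of p * weight q ps"
  by (simp_all add: weight_def power_add)

definition admissible_set :: "nat \<Rightarrow> nat \<Rightarrow> color \<Rightarrow> (color \<Rightarrow> nat) \<Rightarrow> part list set" where
  "admissible_set I m c N = {ps. admissible I m c ps \<and> (\<forall>c'. color_count c' ps = N c')}"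

lemma all_color: "(\<forall>c. P c) \<longleftrightarrow> P A \<and> P B \<and> P U"
  by (metis color.exhaust)

lemma UNIV_color: "(UNIV :: color set) = {A, B, U}"
  using color.exhaust by blast

text \<open>Index \<open>t\<close> is the number of parts preceding a part. With excesses fixed,
  overlining that part raises it and the \<open>t\<close> preceding parts by one, hence q^(t+1);
  only the first \<open>I\<close> parts have the choice.\<close>

definition overline_factor :: "complex \<Rightarrow> nat \<Rightarrow> nat \<Rightarrow> complex" where
  "overline_factor q I s = (\<Prod>t<s. if t < I then 1 + q ^ Suc t else q ^ Suc t)"

text \<open>
  The product of $(q;q)_{i+j+r}$ and \<open>word_sum q c i j r\<close> is the sum, over all color words with
  \<open>i\<close>, \<open>j\<close>, \<open>r\<close> letters \<open>A\<close>, \<open>B\<close>, \<open>U\<close> followed by a virtual part of color \<open>c\<close> and key 0, of $q$ to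
  the total size of the smallest sequence of non-overlined parts with these colors.
\<close>

definition base_sum :: "complex \<Rightarrow> nat \<Rightarrow> nat \<Rightarrow> nat \<Rightarrow> complex" where
  "base_sum q i j r =
     (\<Prod>k<i. q ^ Suc k / (1 - q ^ (2 * Suc k))) * (\<Prod>k<j. q ^ Suc k / (1 - q ^ (2 * Suc k))) *
     (\<Prod>k<i + j. 1 + q ^ Suc k) / (q ^ (i * j) * (\<Prod>k<r. 1 - q ^ Suc k))"

text \<open>Ratio to the case of a virtual part of color \<open>A\<close>. In keys \<open>A\<close>
  and \<open>B\<close> are interchangeable and \<open>base_sum\<close> is symmetric in
  \<open>i\<close> and \<open>j\<close>, so only the extra unit per part of color \<open>B\<close>
  remains, giving q^(j-i). Subtracting the recurrences for \<open>A\<close> and \<open>U\<close>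
  gives the value for \<open>U\<close>: that for \<open>A\<close> minus q times
  \<open>word_sum q B i (j - 1) r\<close> (minus zero if j = 0).\<close>

fun color_factor :: "complex \<Rightarrow> color \<Rightarrow> nat \<Rightarrow> nat \<Rightarrow> complex" where
  "color_factor q A i j = 1"
| "color_factor q B i j = q ^ j / q ^ i"
| "color_factor q U i j = (q ^ (i + j) + q ^ (2 * j)) / (1 + q ^ (i + j))"

definition word_sum :: "complex \<Rightarrow> color \<Rightarrow> nat \<Rightarrow> nat \<Rightarrow> nat \<Rightarrow> complex" where
  "word_sum q c i j r = color_factor q c i j * base_sum q i j r"

definition total_sum :: "complex \<Rightarrow> nat \<Rightarrow> color \<Rightarrow> (color \<Rightarrow> nat) \<Rightarrow> complex" where
  "total_sum q I c N = overline_factor q I (N A + N B + N U) * word_sum q c (N A) (N B) (N U)"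

section \<open>Recurrence by removal of the last part\<close>

context
  fixes q :: complex
  assumes q: "norm q < 1" and q0: "q \<noteq> 0"
begin

lemma one_plus_power_nonzero': "1 + q ^ n \<noteq> 0"
  using one_plus_power_nonzero[OF q, of n] by (cases "n = 0") auto

lemma base_sum_Suc1:
  "base_sum q (Suc i) j r =
     base_sum q i j r * (q ^ Suc i * (1 + q ^ Suc (i + j)) / ((1 - q ^ (2 * Suc i)) * q ^ j))"
  by (simp add: base_sum_def power_add mult_ac)

lemma base_sum_Suc2:
  "base_sum q i (Suc j) r =
     base_sum q i j r * (q ^ Suc j * (1 + q ^ Suc (i + j)) / ((1 - q ^ (2 * Suc j)) * q ^ i))"
  by (simp add: base_sum_def power_add mult_ac)

lemma base_sum_Suc3: "base_sum q i j (Suc r) = base_sum q i j r / (1 - q ^ Suc r)"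
  by (simp add: base_sum_def)

text \<open>\<open>base_sum_Suc1\<close> inverted. The factor 1 - q^(2i) vanishes at i = 0, so one
  formula also covers the case with no part to remove.\<close>

lemma base_sum_pred1:
  "(if i = 0 then 0 else base_sum q (i - 1) j r) =
     base_sum q i j r * (q ^ j * (1 - q ^ (2 * i)) / (q ^ i * (1 + q ^ (i + j))))"
proof (cases i)
  case (Suc k)
  have "1 - q ^ (2 * Suc k) \<noteq> 0" by (rule one_minus_power_nonzero[OF q]) simp
  moreover have "1 + q ^ Suc (k + j) \<noteq> 0" by (rule one_plus_power_nonzero')
  ultimately show ?thesis
    using q0 unfolding Suc base_sum_Suc1 by (simp del: power_Suc mult_Suc_right)
qed simp

lemma base_sum_pred2:
  "(if j = 0 then 0 else base_sum q i (j - 1) r) =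
     base_sum q i j r * (q ^ i * (1 - q ^ (2 * j)) / (q ^ j * (1 + q ^ (i + j))))"
proof (cases j)
  case (Suc k)
  have "1 - q ^ (2 * Suc k) \<noteq> 0" by (rule one_minus_power_nonzero[OF q]) simp
  moreover have "1 + q ^ Suc (i + k) \<noteq> 0" by (rule one_plus_power_nonzero')
  ultimately show ?thesis
    using q0 unfolding Suc base_sum_Suc2 by (simp del: power_Suc mult_Suc_right)
qed simp

lemma base_sum_pred3: "(if r = 0 then 0 else base_sum q i j (r - 1)) = base_sum q i j r * (1 - q ^ r)"
proof (cases r)
  case (Suc k)
  have "1 - q ^ Suc k \<noteq> 0" by (rule one_minus_power_nonzero[OF q]) simp
  then show ?thesis unfolding Suc base_sum_Suc3 by (simp del: power_Suc)
qed simp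

text \<open>The cases are the colors of the last part: its \<open>key_gap\<close> raises all i+j+r
  parts, color \<open>B\<close> costs one more unit, and 1 - q^(i+j+r) stems from the geometric sum
  over its excess.\<close>

lemma word_sum_recurrence:
  "(1 - q ^ (i + j + r)) * word_sum q c i j r =
     (if i = 0 then 0 else q ^ ((i + j + r) * key_gap A c) * word_sum q A (i - 1) j r) +
     (if j = 0 then 0 else q ^ (1 + (i + j + r) * key_gap B c) * word_sum q B i (j - 1) r) +
     (if r = 0 then 0 else q ^ ((i + j + r) * key_gap U c) * word_sum q U i j (r - 1))"
proof -
  define x y z where "x = q ^ i" and "y = q ^ j" and "z = q ^ r"
  define V where "V = base_sum q i j r"
  have nz: "x \<noteq> 0" "y \<noteq> 0" "1 + x * y \<noteq> 0"
    using q0 one_plus_power_nonzero'[of "i + j"] by (auto simp: x_def y_def power_add)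
  define s where "s = i + j + r"
  define a where "a = (if i = 0 then 0 else word_sum q A (i - 1) j r)"
  define b where "b = (if j = 0 then 0 else q * word_sum q B i (j - 1) r)"
  define u where "u = (if r = 0 then 0 else word_sum q U i j (r - 1))"
  have a: "a = V * (y * (1 - x\<^sup>2) / (x * (1 + x * y)))"
    using base_sum_pred1[of i j r]
    by (auto simp: a_def word_sum_def V_def x_def y_def power_add power_mult[symmetric] mult.commute[of 2])
  have b: "b = V * ((1 - y\<^sup>2) / (1 + x * y))"
  proof -
    have "b = y / x * (if j = 0 then 0 else base_sum q i (j - 1) r)"
      by (cases j) (simp_all add: b_def word_sum_def x_def y_def)
    also have "\<dots> = V * ((1 - y\<^sup>2) / (1 + x * y))"
      using nz unfolding base_sum_pred2
      by (simp add: V_def x_def[symmetric] y_def[symmetric] power_add power_mult mult.commute[of 2])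
    finally show ?thesis .
  qed
  have u: "u = V * ((x * y + y\<^sup>2) / (1 + x * y) * (1 - z))"
    using base_sum_pred3[of r i j]
    by (auto simp: u_def word_sum_def V_def x_def y_def z_def power_add power_mult[symmetric] mult.commute[of 2])
  have s: "q ^ s = x * y * z"
    by (simp add: s_def x_def y_def z_def power_add)
  have word_sum: "word_sum q A i j r = V" "word_sum q B i j r = V * (y / x)"
    "word_sum q U i j r = V * ((x * y + y\<^sup>2) / (1 + x * y))"
    by (simp_all add: word_sum_def V_def x_def y_def power_add power_mult[symmetric] mult.commute[of 2])
  \<comment> \<open>In this order, the recurrence for \<open>c\<close> equal to \<open>A\<close>,
    \<open>B\<close>, \<open>U\<close> with the common factor \<open>V\<close> removed.\<close>
  have identities:
    "(1 - x * y * z) * 1 = x * y * z * (y * (1 - x\<^sup>2) / (x * (1 + x * y))) + (1 - y\<^sup>2) / (1 + x * y)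
        + (x * y + y\<^sup>2) / (1 + x * y) * (1 - z)"
    "(1 - x * y * z) * (y / x) = y * (1 - x\<^sup>2) / (x * (1 + x * y)) + x * y * z * ((1 - y\<^sup>2) / (1 + x * y))
        + (x * y + y\<^sup>2) / (1 + x * y) * (1 - z)"
    "(1 - x * y * z) * ((x * y + y\<^sup>2) / (1 + x * y)) =
       x * y * z * (y * (1 - x\<^sup>2) / (x * (1 + x * y))) + x * y * z * ((1 - y\<^sup>2) / (1 + x * y))
        + (x * y + y\<^sup>2) / (1 + x * y) * (1 - z)"
    using nz by (simp_all add: divide_simps) (simp_all add: algebra_simps power2_eq_square)
  have "(1 - q ^ s) * word_sum q c i j r
          = q ^ (s * key_gap A c) * a + q ^ (s * key_gap B c) * b + q ^ (s * key_gap U c) * u"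
  proof (cases c)
    case A
    show ?thesis
      using arg_cong[OF identities(1), of "\<lambda>t. V * t"]
      by (simp only: A word_sum a b u s key_gap_simps mult_0_right mult_1_right power_0) (simp only: distrib_left mult_ac mult_1_left)
  next
    case B
    show ?thesis
      using arg_cong[OF identities(2), of "\<lambda>t. V * t"]
      by (simp only: B word_sum a b u s key_gap_simps mult_0_right mult_1_right power_0) (simp only: distrib_left mult_ac mult_1_left)
  next
    case U
    show ?thesis
      using arg_cong[OF identities(3), of "\<lambda>t. V * t"]
      by (simp only: U word_sum a b u s key_gap_simps mult_0_right mult_1_right power_0) (simp only: distrib_left mult_ac mult_1_left)
  qed
  then show ?thesis
    by (auto simp: s_def a_def b_def u_def)
qed

text \<open>A head of key k contributes q^(k + jag), and the s parts after it in the list, all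
  bounded below by k, contribute q^(k s) times a constant. Summing over k from the least possible
  key is a geometric series of ratio q^(s+1).\<close>

lemma sum_Cons:
  assumes IH: "\<And>k. (weight q has_sum (q ^ (k * s) * x)) (admissible_set I k c' (N(c' := N c' - 1)))"
    and ok: "summable_or_nonneg (weight q) (admissible_set I m c N)"
    and s: "N A + N B + N U = Suc s" and N: "N c' > 0" and o': "I \<le> s \<longrightarrow> o'"
  shows "(weight q has_sum
            (q ^ jag c' * (q ^ ((m + key_gap c' c + of_bool o') * Suc s) / (1 - q ^ Suc s)) * x))
         {ps \<in> admissible_set I m c N. (color_of (hd ps), overlined (hd ps)) = (c', o')}"
proof -
  let ?X = "{ps \<in> admissible_set I m c N. (color_of (hd ps), overlined (hd ps)) = (c', o')}"
  define M where "M = m + key_gap c' c + of_bool o'"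
  have length: "length ps = Suc s" if "ps \<in> admissible_set I m c N" for ps
    using that s length_eq_color_count[of ps] by (simp add: admissible_set_def)
  have fibre: "{ps \<in> ?X. size_of (hd ps) - jag (color_of (hd ps)) = k}
      = (#) (Part (k + jag c') c' o') ` admissible_set I k c' (N(c' := N c' - 1))"
    (is "?L = ?R") if k: "k \<in> {M..}" for k
  proof (intro set_eqI iffI)
    fix ps assume ps: "ps \<in> ?L"
    then obtain p qs where ps_eq: "ps = p # qs"
      using length[of ps] by (cases ps) auto
    have "ps = Part (k + jag c') c' o' # qs"
      using ps unfolding ps_eq by (cases p) (auto simp: admissible_set_def)
    moreover have "qs \<in> admissible_set I k c' (N(c' := N c' - 1))"
      using ps unfolding ps_eq by (auto simp: admissible_set_def all_color split: if_splits)
    ultimately show "ps \<in> ?R" by blast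
  next
    fix ps assume "ps \<in> ?R"
    then obtain qs where qs: "ps = Part (k + jag c') c' o' # qs"
      "qs \<in> admissible_set I k c' (N(c' := N c' - 1))" by blast
    then have "color_count c'' ps = N c''" for c''
      using N by (auto simp: admissible_set_def)
    moreover from this have "length qs = s"
      using s length_eq_color_count[of ps] qs by simp
    ultimately show "ps \<in> ?L"
      using qs k o' by (auto simp: admissible_set_def M_def)
  qed
  have "(weight q has_sum (q ^ jag c' * (q ^ (M * Suc s) / (1 - q ^ Suc s)) * x)) ?X"
  proof (rule has_sum_fibres)
    show "(weight q has_sum (q ^ jag c' * (q ^ Suc s) ^ k * x))
            {ps \<in> ?X. size_of (hd ps) - jag (color_of (hd ps)) = k}" if "k \<in> {M..}" for k
    proof -
      have "((\<lambda>ps. q ^ (k + jag c') * weight q ps) has_sum (q ^ (k + jag c') * (q ^ (k * s) * x)))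
              (admissible_set I k c' (N(c' := N c' - 1)))"
        by (intro has_sum_cmult_right IH)
      moreover have "q ^ (k + jag c') * (q ^ (k * s) * x) = q ^ jag c' * (q ^ Suc s) ^ k * x"
        by (simp add: power_add power_mult[symmetric] power_mult_distrib mult_ac)
      ultimately show ?thesis
        unfolding fibre[OF that] by (subst has_sum_reindex) (auto simp: o_def)
    qed
    have "norm (q ^ Suc s) < 1"
      using q by (simp add: norm_power power_less_one_iff del: power_Suc)
    then have "((\<lambda>k. q ^ jag c' * (q ^ Suc s) ^ k * x) has_sum
                 (q ^ jag c' * ((q ^ Suc s) ^ M / (1 - q ^ Suc s)) * x)) {M..}"
      by (intro has_sum_cmult_left has_sum_cmult_right has_sum_geometric_atLeast)
    then show "((\<lambda>k. q ^ jag c' * (q ^ Suc s) ^ k * x) has_sum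
                 (q ^ jag c' * (q ^ (M * Suc s) / (1 - q ^ Suc s)) * x)) {M..}"
      by (simp only: power_mult[symmetric] mult.commute[of "Suc s"])
    show "(\<lambda>ps. size_of (hd ps) - jag (color_of (hd ps))) ` ?X \<subseteq> {M..}"
    proof (rule image_subsetI)
      fix ps assume "ps \<in> ?X"
      moreover from this have "ps \<noteq> []" using length[of ps] by auto
      ultimately show "size_of (hd ps) - jag (color_of (hd ps)) \<in> {M..}"
        by (cases ps) (auto simp: admissible_set_def M_def)
    qed
    show "summable_or_nonneg (weight q) ?X"
      by (rule summable_or_nonneg_subset[OF ok]) auto
  qed
  then show ?thesis unfolding M_def .
qed

lemma sum_overlines:
  fixes x :: complex
  shows "(\<Sum>o'\<in>{o'. I \<le> s \<longrightarrow> o'}. q ^ ((n + of_bool o') * Suc s) / d)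
     = (if s < I then 1 + q ^ Suc s else q ^ Suc s) * q ^ (n * Suc s) / d"
proof -
  have "{o'. I \<le> s \<longrightarrow> o'} = (if s < I then {True, False} else {True})"
    by auto
  then show ?thesis
    by (simp add: power_add add_divide_distrib algebra_simps)
qed

text \<open>Induction on the number of parts, splitting by color and overline of the head. The
  starting key \<open>m\<close> shifts every part. The overline choices give the next factor of
  \<open>overline_factor\<close>, and the colors combine by
  \<open>word_sum_recurrence\<close>.\<close>

lemma has_sum_weight:
  assumes ok: "\<And>I m c N. summable_or_nonneg (weight q) (admissible_set I m c N)"
  shows "(weight q has_sum (q ^ (m * (N A + N B + N U)) * total_sum q I c N)) (admissible_set I m c N)"
proof (induction "N A + N B + N U" arbitrary: m c N)
  case 0
  then have N: "N A = 0" "N B = 0" "N U = 0" by auto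
  have "admissible_set I m c N = {[]}"
  proof -
    have "ps = []" if "ps \<in> admissible_set I m c N" for ps
      using that 0 length_eq_color_count[of ps] by (simp add: admissible_set_def)
    then show ?thesis
      using N by (auto simp: admissible_set_def all_color)
  qed
  moreover have "total_sum q I c N = 1"
    by (cases c) (simp_all add: total_sum_def overline_factor_def word_sum_def base_sum_def N)
  ultimately show ?case
    using has_sum_finite[of "{[]}" "weight q"] by (simp add: N)
next
  case (Suc s)
  define Y where "Y = (SIGMA c':{c'. N c' > 0}. {o'. I \<le> s \<longrightarrow> o'})"
  define N' where "N' = (\<lambda>c'. N(c' := N c' - 1))"
  define T where "T = (\<lambda>(c', o'). q ^ jag c' * (q ^ ((m + key_gap c' c + of_bool o') * Suc s)
                          / (1 - q ^ Suc s)) * total_sum q I c' (N' c'))"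
  define f where "f = (if s < I then 1 + q ^ Suc s else q ^ Suc s)"
  have N's: "N' c' A + N' c' B + N' c' U = s" if "N c' > 0" for c'
    using that Suc(2) by (cases c') (auto simp: N'_def)
  have "(weight q has_sum sum T Y) (admissible_set I m c N)"
  proof (rule has_sum_fibres)
    show "(weight q has_sum T y) {ps \<in> admissible_set I m c N. (color_of (hd ps), overlined (hd ps)) = y}"
      if "y \<in> Y" for y
    proof -
      obtain c' o' where y: "y = (c', o')" by fastforce
      show ?thesis unfolding y T_def prod.case
      proof (rule sum_Cons[OF _ ok])
        show "(weight q has_sum (q ^ (k * s) * total_sum q I c' (N' c')))
                (admissible_set I k c' (N(c' := N c' - 1)))" for k
          using Suc(1)[of "N' c'" k c'] N's that by (auto simp: N'_def y Y_def)
      qed (use that Suc(2) in \<open>auto simp: y Y_def\<close>)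
    qed
    show "(T has_sum sum T Y) Y"
    proof (rule has_sum_finite)
      have "finite (UNIV :: color set)" by (simp add: UNIV_color)
      then show "finite Y" unfolding Y_def by (intro finite_SigmaI) (auto intro: finite_subset)
    qed
    show "(\<lambda>ps. (color_of (hd ps), overlined (hd ps))) ` admissible_set I m c N \<subseteq> Y"
    proof clarify
      fix ps assume ps: "ps \<in> admissible_set I m c N"
      then have len: "length ps = Suc s"
        using Suc(2) length_eq_color_count[of ps] by (simp add: admissible_set_def)
      then obtain p qs where ps_eq: "ps = p # qs" by (cases ps) auto
      have "N (color_of p) = color_count (color_of p) ps"
        using ps by (simp add: admissible_set_def)
      then show "(color_of (hd ps), overlined (hd ps)) \<in> Y"
        using ps len by (auto simp: ps_eq Y_def admissible_set_def)
    qed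
    show "summable_or_nonneg (weight q) (admissible_set I m c N)" by (rule ok)
  qed
  moreover have "sum T Y = q ^ (m * Suc s) * total_sum q I c N"
  proof -
    define W where "W = (\<lambda>c'. q ^ (jag c' + Suc s * key_gap c' c) *
                        word_sum q c' (N' c' A) (N' c' B) (N' c' U))"
    have "sum T Y = (\<Sum>c' | N c' > 0. \<Sum>o' | I \<le> s \<longrightarrow> o'. T (c', o'))"
      unfolding Y_def by (simp add: sum.cartesian_product)
    also have "\<dots> = (\<Sum>c' | N c' > 0. q ^ (m * Suc s) / (1 - q ^ Suc s) * overline_factor q I (Suc s) * W c')"
    proof (rule sum.cong[OF refl])
      fix c' assume "c' \<in> {c'. N c' > 0}"
      then have c': "N c' > 0" by simp
      have "(\<Sum>o' | I \<le> s \<longrightarrow> o'. T (c', o')) =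
          q ^ jag c' * (\<Sum>o' | I \<le> s \<longrightarrow> o'. q ^ ((m + key_gap c' c + of_bool o') * Suc s)
                          / (1 - q ^ Suc s)) * total_sum q I c' (N' c')"
        unfolding T_def prod.case by (simp only: sum_distrib_left sum_distrib_right)
      also have "\<dots> = q ^ jag c' * (f * q ^ ((m + key_gap c' c) * Suc s) / (1 - q ^ Suc s))
                        * total_sum q I c' (N' c')"
        unfolding sum_overlines f_def ..
      also have "\<dots> = q ^ (m * Suc s) / (1 - q ^ Suc s) * overline_factor q I (Suc s) * W c'"
      proof -
        have "total_sum q I c' (N' c') = overline_factor q I s * word_sum q c' (N' c' A) (N' c' B) (N' c' U)"
          unfolding total_sum_def N's[OF c'] ..
        moreover have "overline_factor q I (Suc s) = overline_factor q I s * f"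
          by (simp add: overline_factor_def f_def)
        moreover have "q ^ ((m + key_gap c' c) * Suc s) = q ^ (m * Suc s) * q ^ (Suc s * key_gap c' c)"
          by (simp only: add_mult_distrib power_add mult.commute[of "Suc s"])
        ultimately show ?thesis
          unfolding W_def power_add[of q "jag c'"] by simp
      qed
      finally show "(\<Sum>o' | I \<le> s \<longrightarrow> o'. T (c', o')) =
         q ^ (m * Suc s) / (1 - q ^ Suc s) * overline_factor q I (Suc s) * W c'" .
    qed
    also have "\<dots> = q ^ (m * Suc s) / (1 - q ^ Suc s) * overline_factor q I (Suc s) * (\<Sum>c' | N c' > 0. W c')"
      by (simp only: sum_distrib_left)
    \<comment> \<open>Colors with no part left are the zero branches of the recurrence.\<close>
    also have "(\<Sum>c' | N c' > 0. W c') = (\<Sum>c'\<in>{A, B, U}. if N c' = 0 then 0 else W c')"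
      by (rule sum.mono_neutral_cong_left) (auto intro: color.exhaust)
    also have "\<dots> = (1 - q ^ Suc s) * word_sum q c (N A) (N B) (N U)"
      unfolding word_sum_recurrence[of "N A" "N B" "N U" c, folded Suc(2)]
      by (simp add: W_def N'_def)
    finally show ?thesis
      using one_minus_power_nonzero[OF q, of "Suc s"]
      by (simp add: total_sum_def Suc(2)[symmetric] del: power_Suc)
  qed
  ultimately show ?case
    using Suc(2) by simp
qed

end

section \<open>Summation over the color counts\<close>

definition colored_weight :: "complex \<Rightarrow> complex \<Rightarrow> complex \<Rightarrow> part list \<Rightarrow> complex" where
  "colored_weight a b q ps = a ^ color_count A ps * b ^ color_count B ps * weight q ps"

text \<open>These are the reversals of the counted sequences of every size: the number of leading
  parts that may stay plain is the number of parts of color \<open>A\<close>.\<close>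

definition all_admissible :: "part list set" where
  "all_admissible = {ps. admissible (color_count A ps) 0 A ps}"

text \<open>At |q| all weights are non-negative, so \<open>has_sum_weight\<close> applies through
  that alternative; comparison of norms transfers summability to q.\<close>

lemma weight_summable:
  assumes q: "norm q < 1" and q0: "q \<noteq> 0"
  shows "weight q summable_on admissible_set I m c N"
proof -
  define Q :: complex where "Q = of_real (norm q)"
  have "(weight Q has_sum (Q ^ (m * (N A + N B + N U)) * total_sum Q I c N)) (admissible_set I m c N)"
  proof (rule has_sum_weight)
    show "norm Q < 1" "Q \<noteq> 0" using q q0 by (auto simp: Q_def)
    show "summable_or_nonneg (weight Q) (admissible_set I m c N)" for I m c N
      by (auto simp: summable_or_nonneg_def weight_def Q_def)
  qed
  then have "(\<lambda>ps. norm (weight Q ps)) summable_on admissible_set I m c N"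
    unfolding summable_on_iff_abs_summable_on_complex[symmetric] by (auto simp: summable_on_def)
  then have "(\<lambda>ps. norm (weight q ps)) summable_on admissible_set I m c N"
    by (rule Infinite_Sum.abs_summable_on_comparison_test) (simp add: weight_def Q_def norm_power)
  then show ?thesis by (rule Infinite_Sum.abs_summable_summable)
qed

text \<open>The first i overline factors 1 + q^(k+1) cancel against 1 - q^(2(k+1)), leaving the
  Euler term in i. The later ones are pure powers: those for j absorb the division by q^(i j) and
  turn the base into q^2, those for r give the Euler term in r.\<close>

lemma overline_factor_base_sum:
  assumes q: "norm q < 1" and q0: "q \<noteq> 0"
  shows "overline_factor q i (i + j + r) * base_sum q i j r =
     euler_term q q i * euler_term (q ^ 2) (q ^ 2) j * qpoch (- q) q (i + j) * euler_term (q * q ^ (i + j)) q r"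
proof (induction r)
  case 0
  show ?case
  proof (induction j)
    case 0
    have "overline_factor q i i * (\<Prod>k<i. q ^ Suc k / (1 - q ^ (2 * Suc k))) = euler_term q q i"
      unfolding overline_factor_def euler_term_def prod.distrib[symmetric]
    proof (rule prod.cong[OF refl])
      fix k assume k: "k \<in> {..<i}"
      have "1 - q ^ (2 * Suc k) = (1 - q ^ Suc k) * (1 + q ^ Suc k)"
        by (subst power_mult, subst power2_eq_square) (simp add: power_mult_distrib algebra_simps power2_eq_square power_add mult_2)
      moreover have "1 + q ^ Suc k \<noteq> 0" by (rule one_plus_power_nonzero[OF q]) simp
      ultimately show "(if k < i then 1 + q ^ Suc k else q ^ Suc k) * (q ^ Suc k / (1 - q ^ (2 * Suc k)))
              = q * q ^ k / (1 - q ^ Suc k)"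
        using k by simp
    qed
    then show ?case
      by (simp add: base_sum_def qpoch_def)
  next
    case (Suc j)
    have ov: "overline_factor q i (i + Suc j + 0) = overline_factor q i (i + j + 0) * q ^ Suc (i + j)"
      by (simp add: overline_factor_def)
    have bs: "base_sum q i (Suc j) 0 = base_sum q i j 0 * (q ^ Suc j * (1 + q ^ Suc (i + j)) / ((1 - q ^ (2 * Suc j)) * q ^ i))"
      by (rule base_sum_Suc2[OF q q0])
    have et: "euler_term (q ^ 2) (q ^ 2) (Suc j) = euler_term (q ^ 2) (q ^ 2) j * (q ^ Suc j * q ^ Suc j / (1 - q ^ (2 * Suc j)))"
      unfolding euler_term_Suc power_Suc[of "q ^ 2", symmetric] power_mult[symmetric]
        power_add[symmetric] mult_2 by (simp add: power_add power2_eq_square)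
    have qp: "qpoch (- q) q (i + Suc j) = qpoch (- q) q (i + j) * (1 + q ^ Suc (i + j))"
      by (simp add: qpoch_def)
    have ratio: "q ^ Suc (i + j) * (q ^ Suc j * (1 + q ^ Suc (i + j)) / ((1 - q ^ (2 * Suc j)) * q ^ i))
        = q ^ Suc j * q ^ Suc j / (1 - q ^ (2 * Suc j)) * (1 + q ^ Suc (i + j))"
      using q0 by (simp add: power_add mult_ac del: mult_Suc_right)
    have "overline_factor q i (i + Suc j + 0) * base_sum q i (Suc j) 0
      = (overline_factor q i (i + j + 0) * base_sum q i j 0)
        * (q ^ Suc (i + j) * (q ^ Suc j * (1 + q ^ Suc (i + j)) / ((1 - q ^ (2 * Suc j)) * q ^ i)))"
      unfolding ov bs by (simp only: mult_ac)
    also have "\<dots> = euler_term q q i * euler_term (q ^ 2) (q ^ 2) (Suc j) * qpoch (- q) q (i + Suc j)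
        * euler_term (q * q ^ (i + Suc j)) q 0"
      unfolding Suc ratio et qp by simp
    finally show ?case .
  qed
next
  case (Suc r)
  have "overline_factor q i (i + j + Suc r) = overline_factor q i (i + j + r) * q ^ Suc (i + j + r)"
    by (simp add: overline_factor_def)
  then show ?case
    using Suc unfolding base_sum_Suc3[OF q q0] euler_term_Suc by (simp add: power_add mult_ac)
qed

lemma has_sum_colored_weight:
  assumes q: "norm q < 1" and q0: "q \<noteq> 0"
    and ok: "summable_or_nonneg (colored_weight a b q) all_admissible"
  shows "(colored_weight a b q has_sum
           (qpoch_inf (- q) q * qpoch_inf (- (a * q)) q * qpoch_inf (- (b * q ^ 2)) (q ^ 2))) all_admissible"
    (is "(_ has_sum (?P * ?Pa * ?Pb)) _")
proof -
  note ok' = summable_or_nonneg_subset[OF ok]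
  have q2: "norm (q ^ 2) < 1" using q by (simp add: norm_power power_less_one_iff)
  define F where "F i j r = {ps \<in> {ps \<in> {ps \<in> all_admissible. color_count A ps = i}.
      color_count B ps = j}. color_count U ps = r}" for i j r
  have r: "(colored_weight a b q has_sum (euler_term (a * q) q i * euler_term (b * q ^ 2) (q ^ 2) j
         * qpoch (- q) q (i + j) * euler_term (q * q ^ (i + j)) q r)) (F i j r)" for i j r
  proof -
    define N where "N = (\<lambda>c. case c of A \<Rightarrow> i | B \<Rightarrow> j | U \<Rightarrow> r)"
    have F: "F i j r = admissible_set i 0 A N"
      by (auto simp: F_def all_admissible_def admissible_set_def all_color N_def)
    have "(weight q has_sum (q ^ (0 * (N A + N B + N U)) * total_sum q i A N)) (F i j r)"
      unfolding F using weight_summable[OF q q0]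
      by (intro has_sum_weight q q0) (simp add: summable_or_nonneg_def)
    moreover have "total_sum q i A N = overline_factor q i (i + j + r) * base_sum q i j r"
      by (simp add: total_sum_def word_sum_def N_def)
    ultimately have "((\<lambda>ps. a ^ i * b ^ j * weight q ps) has_sum
        (a ^ i * b ^ j * (overline_factor q i (i + j + r) * base_sum q i j r))) (F i j r)"
      by (intro has_sum_cmult_right) simp
    \<comment> \<open>By \<open>euler_term_eq\<close> the powers of a and b move into the arguments
      of the Euler terms.\<close>
    also have "a ^ i * b ^ j * (overline_factor q i (i + j + r) * base_sum q i j r)
        = euler_term (a * q) q i * euler_term (b * q ^ 2) (q ^ 2) j
         * qpoch (- q) q (i + j) * euler_term (q * q ^ (i + j)) q r"
      unfolding overline_factor_base_sum[OF q q0] euler_term_eq[of "a * q"] euler_term_eq[of q]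
         euler_term_eq[of "q ^ 2"] euler_term_eq[of "b * q ^ 2"]
      by (simp add: power_mult_distrib)
    finally show ?thesis
      by (rule has_sum_cong[THEN iffD1, rotated]) (simp add: F_def colored_weight_def)
  qed
  have j: "(colored_weight a b q has_sum (euler_term (a * q) q i * euler_term (b * q ^ 2) (q ^ 2) j * ?P))
            {ps \<in> {ps \<in> all_admissible. color_count A ps = i}. color_count B ps = j}" for i j
  proof (rule has_sum_fibres[where g = "color_count U" and Y = UNIV])
    have "(euler_term (q * q ^ (i + j)) q has_sum qpoch_inf (- (q * q ^ (i + j))) q) UNIV"
      by (rule euler_identity[OF q])
    then have "((\<lambda>r. euler_term (a * q) q i * euler_term (b * q ^ 2) (q ^ 2) j * qpoch (- q) q (i + j)
                * euler_term (q * q ^ (i + j)) q r) has_sum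
         (euler_term (a * q) q i * euler_term (b * q ^ 2) (q ^ 2) j * qpoch (- q) q (i + j)
            * qpoch_inf (- (q * q ^ (i + j))) q)) UNIV"
      by (rule has_sum_cmult_right)
    \<comment> \<open>The sum over \<open>U\<close> removes the only factors that couple i and j,
      which is why it is taken first.\<close>
    moreover have "qpoch (- q) q (i + j) * qpoch_inf (- (q * q ^ (i + j))) q = ?P"
      using qpoch_inf_split[OF q, of "- q" "i + j"] by simp
    ultimately show "((\<lambda>r. euler_term (a * q) q i * euler_term (b * q ^ 2) (q ^ 2) j * qpoch (- q) q (i + j)
                * euler_term (q * q ^ (i + j)) q r) has_sum
         (euler_term (a * q) q i * euler_term (b * q ^ 2) (q ^ 2) j * ?P)) UNIV"
      by (simp add: mult.assoc)
  qed (use r in \<open>auto simp: F_def intro: ok'\<close>)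
  have i: "(colored_weight a b q has_sum (euler_term (a * q) q i * (?Pb * ?P)))
            {ps \<in> all_admissible. color_count A ps = i}" for i
  proof (rule has_sum_fibres[where g = "color_count B" and Y = UNIV])
    have "((\<lambda>j. euler_term (a * q) q i * (euler_term (b * q ^ 2) (q ^ 2) j * ?P)) has_sum
            (euler_term (a * q) q i * (?Pb * ?P))) UNIV"
      by (intro has_sum_cmult_right has_sum_cmult_left euler_identity q2)
    then show "((\<lambda>j. euler_term (a * q) q i * euler_term (b * q ^ 2) (q ^ 2) j * ?P) has_sum
            (euler_term (a * q) q i * (?Pb * ?P))) UNIV"
      by (simp add: mult.assoc)
  qed (use j in \<open>auto intro: ok'\<close>)
  have "(colored_weight a b q has_sum (?Pa * (?Pb * ?P))) all_admissible"
  proof (rule has_sum_fibres[where g = "color_count A" and Y = UNIV])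
    show "((\<lambda>i. euler_term (a * q) q i * (?Pb * ?P)) has_sum (?Pa * (?Pb * ?P))) UNIV"
      by (intro has_sum_cmult_left euler_identity q)
  qed (use i ok in auto)
  then show ?thesis by (simp add: mult_ac)
qed

text \<open>The comparison of \<open>weight_summable\<close>, now with the norms of a and b as
  well.\<close>

lemma colored_weight_summable:
  assumes q: "norm q < 1" and q0: "q \<noteq> 0"
  shows "colored_weight a b q summable_on all_admissible"
proof -
  define a' b' q' :: complex where "a' = of_real (norm a)" and "b' = of_real (norm b)"
    and "q' = of_real (norm q)"
  have "summable_or_nonneg (colored_weight a' b' q') all_admissible"
    by (auto simp: summable_or_nonneg_def colored_weight_def weight_def a'_def b'_def q'_def)
  then have "colored_weight a' b' q' summable_on all_admissible"
    using has_sum_colored_weight[of q' a' b'] q q0 by (auto simp: summable_on_def q'_def)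
  then have "(\<lambda>ps. norm (colored_weight a' b' q' ps)) summable_on all_admissible"
    by (simp only: summable_on_iff_abs_summable_on_complex)
  then have "(\<lambda>ps. norm (colored_weight a b q ps)) summable_on all_admissible"
    by (rule Infinite_Sum.abs_summable_on_comparison_test)
       (simp add: colored_weight_def weight_def a'_def b'_def q'_def norm_mult norm_power)
  then show ?thesis by (rule Infinite_Sum.abs_summable_summable)
qed

section \<open>Return to the counted sequences\<close>

lemma C2_0: "C2 0 k i j = of_bool (k = 0 \<and> i = 0 \<and> j = 0)"
proof -
  have "ps = []" if "ps \<in> C2_set 0 k i j" for ps
  proof (rule ccontr)
    assume "ps \<noteq> []"
    then have "hd ps \<in> set ps" by simp
    moreover from this have "size_of (hd ps) > 0" by (rule C2_set_positive[OF that])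
    moreover have "sum_list (map size_of ps) = 0"
      using that by (simp add: C2_set_def jagged_overpartition_def)
    ultimately show False by auto
  qed
  moreover have "[] \<in> C2_set 0 k i j \<longleftrightarrow> k = 0 \<and> i = 0 \<and> j = 0"
    by (auto simp: C2_set_def jagged_overpartition_def final_parts_overlined_def)
  ultimately have "C2_set 0 k i j = (if k = 0 \<and> i = 0 \<and> j = 0 then {[]} else {})"
    by (auto split: if_splits)
  then show ?thesis by (simp add: C2_def)
qed

theorem theorem1p9:
  fixes a b q :: complex
  assumes "norm q < 1"
  shows "((\<lambda>(n, k, i, j). of_nat (C2 n k i j) * a ^ i * b ^ j * q ^ n)
           has_sum (qpoch_inf (- q) q * qpoch_inf (- a * q) q * qpoch_inf (- b * q ^ 2) (q ^ 2)))
         (UNIV :: (nat \<times> nat \<times> nat \<times> nat) set)"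
    (is "(?f has_sum ?P) UNIV")
proof (cases "q = 0")
  \<comment> \<open>The closed form divides by powers of q, so q = 0 is treated apart; there only n
    = 0 contributes, through 0^0 = 1.\<close>
  case True
  have "(?f has_sum ?P) UNIV \<longleftrightarrow> (?f has_sum ?P) {(0, 0, 0, 0)}"
    using True by (intro has_sum_cong_neutral) (auto simp: C2_0)
  also have "\<dots>"
    by (rule has_sum_finiteI) (simp_all add: True C2_0 qpoch_inf_def)
  finally show ?thesis .
next
  case False
  define X where "X = {ps. jagged_overpartition (sum_list (map size_of ps)) ps \<and> final_parts_overlined ps}"
  have X: "ps \<in> X \<longleftrightarrow> rev ps \<in> all_admissible" for ps
    using jagged_overpartition_iff[OF refl refl, of ps] by (simp add: X_def all_admissible_def)
  have "bij_betw rev X all_admissible"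
    by (rule bij_betwI[of _ _ _ rev]) (auto simp: X)
  moreover have "(colored_weight a b q has_sum ?P) all_admissible"
    using has_sum_colored_weight[OF assms False] colored_weight_summable[OF assms False]
    by (simp add: summable_or_nonneg_def)
  ultimately have "((\<lambda>ps. colored_weight a b q (rev ps)) has_sum ?P) X"
    by (simp add: has_sum_reindex_bij_betw)
  then show ?thesis
  \<comment> \<open>Each fibre over (n, k, i, j) is the finite set \<open>C2_set n k i j\<close>, on
    which the weight is constant; \<open>k\<close> refines the grouping but carries no
    variable.\<close>
  proof (rule has_sum_fibresD)
    fix y :: "nat \<times> nat \<times> nat \<times> nat"
    obtain n k i j where y: "y = (n, k, i, j)" using prod_cases4 by blast
    have "{ps \<in> X. (sum_list (map size_of ps), length (filter (\<lambda>p. \<not> overlined p) ps),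
              color_count A ps, color_count B ps) = y} = C2_set n k i j"
      by (auto simp: y X_def C2_set_def color_count_def jagged_overpartition_def)
    moreover have "((\<lambda>ps. colored_weight a b q (rev ps)) has_sum ?f y) (C2_set n k i j)"
    proof (rule has_sum_finiteI[OF finite_C2_set])
      have "colored_weight a b q (rev ps) = a ^ i * b ^ j * q ^ n" if "ps \<in> C2_set n k i j" for ps
        using that by (simp add: colored_weight_def weight_def C2_set_def jagged_overpartition_def
            color_count_def[symmetric] rev_map[symmetric])
      then show "?f y = (\<Sum>ps\<in>C2_set n k i j. colored_weight a b q (rev ps))"
        by (simp add: y C2_def)
    qed
    ultimately show "((\<lambda>ps. colored_weight a b q (rev ps)) has_sum ?f y)
        {ps \<in> X. (sum_list (map size_of ps), length (filter (\<lambda>p. \<not> overlined p) ps),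
              color_count A ps, color_count B ps) = y}"
      by simp
  qed simp
qed

end
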